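(* Let $(X,d)$ be a metric space, $(X,\delta)$ be a semimetric space, and let $T\colon X\to X$ be an A.M.-G.M. contraction (with the semimetric $\delta$), i.e. there exists $\alpha\in[0,1)$ such that $$\frac{d(Tx,Ty)+\delta(Tx,Ty)}{2}\le\alpha\,\big(d(x,y)\,\delta(x,y)\big)^{1/2}\quad\text{for all }x,y\in X.$$ Then $T$ is a Picard operator provided that $\delta$ is strongly $d$-regular.
   Context: $X$ is a nonempty set. $(X,\delta)$ is a semimetric space if $\delta\colon X\times X\to[0,\infty)$ is a semimetric, i.e. $\delta(x,y)=0$ if and only if $x=y$, and $\delta(x,y)=\delta(y,x)$ for all $x,y\in X$ (no triangle inequality is required). The semimetric $\delta$ is strongly $d$-regular if for every $x^*\in X$ and every sequence $(x_n)$ in $X$ with $d(x_n,x^* )\to0$ we have $\delta(x_n,x^* )\to0$. A self-mapping $T$ of a metric space $(X,d)$ is called a Picard operator if $T$ has a unique fixed point $u\in X$ and for every $x\in X$ the sequence of iterates $(T^n x)$ converges to $u$ in $(X,d)$.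
   Formalization: The metric space (X,d) is assumed complete; without this the claim fails, e.g. X=(0,1], d=δ=|x−y|, Tx=x/2, α=1/2 satisfies all hypotheses but T has no fixed point. *)

theory Defs
  imports "HOL-Analysis.Abstract_Metric_Spaces"
begin

definition semimetric_on :: "'a set \<Rightarrow> ('a \<Rightarrow> 'a \<Rightarrow> real) \<Rightarrow> bool" where
  "semimetric_on X \<delta> \<longleftrightarrow>
     (\<forall>x\<in>X. \<forall>y\<in>X. 0 \<le> \<delta> x y \<and> (\<delta> x y = 0 \<longleftrightarrow> x = y) \<and> \<delta> x y = \<delta> y x)"

definition strongly_regular_on ::
    "'a set \<Rightarrow> ('a \<Rightarrow> 'a \<Rightarrow> real) \<Rightarrow> ('a \<Rightarrow> 'a \<Rightarrow> real) \<Rightarrow> bool" where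
  "strongly_regular_on X d \<delta> \<longleftrightarrow>
     (\<forall>z\<in>X. \<forall>x. range x \<subseteq> X \<longrightarrow> (\<lambda>n::nat. d (x n) z) \<longlonglongrightarrow> 0
        \<longrightarrow> (\<lambda>n. \<delta> (x n) z) \<longlonglongrightarrow> 0)"

definition am_gm_contraction_on ::
    "'a set \<Rightarrow> ('a \<Rightarrow> 'a \<Rightarrow> real) \<Rightarrow> ('a \<Rightarrow> 'a \<Rightarrow> real) \<Rightarrow> ('a \<Rightarrow> 'a) \<Rightarrow> bool" where
  "am_gm_contraction_on X d \<delta> T \<longleftrightarrow>
     (\<exists>\<alpha>. 0 \<le> \<alpha> \<and> \<alpha> < 1 \<and>
        (\<forall>x\<in>X. \<forall>y\<in>X. (d (T x) (T y) + \<delta> (T x) (T y)) / 2 \<le> \<alpha> * sqrt (d x y * \<delta> x y)))"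

definition picard_operator_on :: "'a set \<Rightarrow> ('a \<Rightarrow> 'a \<Rightarrow> real) \<Rightarrow> ('a \<Rightarrow> 'a) \<Rightarrow> bool" where
  "picard_operator_on X d T \<longleftrightarrow>
     (\<exists>u\<in>X. T u = u \<and> (\<forall>v\<in>X. T v = v \<longrightarrow> v = u) \<and>
        (\<forall>x\<in>X. limitin (Metric_space.mtopology X d) (\<lambda>n. (T ^^ n) x) u sequentially))"

end

(* By the AM-GM inequality, T contracts the semimetric d + \<delta> by the factor \<alpha>. Hence the d-steps
   along an orbit decay geometrically and the orbit converges to some u. Strong regularity upgrades
   this to convergence in d + \<delta>, so contracting once more shows that the orbit also tends to T u. *)
theory Submission
  imports Defs
begin

text \<open>The distance from \<open>x n\<close> to any later term is at most a tail of a geometric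
  series, \<open>C / (1 - \<alpha>) * \<alpha> ^ n\<close>, which vanishes as n grows.\<close>

lemma (in Metric_space) MCauchy_geometric:
  assumes x: "range x \<subseteq> M" and \<alpha>: "0 \<le> \<alpha>" "\<alpha> < 1"
    and step: "\<And>n. d (x n) (x (Suc n)) \<le> C * \<alpha> ^ n"
  shows "MCauchy x"
proof -
  have xM: "x n \<in> M" for n
    using x by auto
  have C: "0 \<le> C"
    using order_trans[OF nonneg step[of 0]] by simp
  \<comment> \<open>The exact finite geometric sum is kept so that the induction closes: the cruder
    bound without \<open>1 - \<alpha> ^ k\<close> would not absorb the next step.\<close>
  have telescope: "d (x n) (x (n + k)) \<le> C * \<alpha> ^ n * (1 - \<alpha> ^ k) / (1 - \<alpha>)" for n k
  proof (induction k)
    case 0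
    then show ?case using xM by simp
  next
    case (Suc k)
    have "d (x n) (x (n + Suc k)) \<le> d (x n) (x (n + k)) + d (x (n + k)) (x (Suc (n + k)))"
      using triangle xM by simp
    also have "\<dots> \<le> C * \<alpha> ^ n * (1 - \<alpha> ^ k) / (1 - \<alpha>) + C * \<alpha> ^ (n + k)"
      using Suc.IH step[of "n + k"] by linarith
    also have "\<dots> = C * \<alpha> ^ n * (1 - \<alpha> ^ Suc k) / (1 - \<alpha>)"
      using \<alpha> by (simp add: field_simps power_add)
    finally show ?case .
  qed
  have tail: "d (x N) (x n) \<le> C / (1 - \<alpha>) * \<alpha> ^ N" if "N \<le> n" for N n
  proof -
    have "d (x N) (x n) \<le> C * \<alpha> ^ N * (1 - \<alpha> ^ (n - N)) / (1 - \<alpha>)"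
      using telescope[of N "n - N"] that by simp
    also have "\<dots> \<le> C * \<alpha> ^ N * 1 / (1 - \<alpha>)"
      using \<alpha> C by (intro divide_right_mono mult_left_mono) auto
    finally show ?thesis by simp
  qed
  show ?thesis
    unfolding MCauchy_def
  proof (intro conjI x allI impI)
    fix \<epsilon> :: real assume "\<epsilon> > 0"
    \<comment> \<open>The factor 2 arises because two terms beyond N are compared through
      \<open>x N\<close>, at the cost of one tail each.\<close>
    have "(\<lambda>N. 2 * (C / (1 - \<alpha>) * \<alpha> ^ N)) \<longlonglongrightarrow> 2 * (C / (1 - \<alpha>) * 0)"
      using \<alpha> by (intro tendsto_intros LIMSEQ_realpow_zero) auto
    then have "\<forall>\<^sub>F N in sequentially. 2 * (C / (1 - \<alpha>) * \<alpha> ^ N) < \<epsilon>"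
      using \<open>\<epsilon> > 0\<close> by (auto dest: order_tendstoD)
    then obtain N where N: "2 * (C / (1 - \<alpha>) * \<alpha> ^ N) < \<epsilon>"
      by (auto simp: eventually_sequentially)
    have "d (x n) (x m) < \<epsilon>" if "N \<le> n" "N \<le> m" for n m
      using triangle[OF xM xM xM, of n m N] commute[of "x n" "x N"] tail[OF that(1)] tail[OF that(2)] N
      by linarith
    then show "\<exists>N. \<forall>n m. N \<le> n \<longrightarrow> N \<le> m \<longrightarrow> d (x n) (x m) < \<epsilon>"
      by blast
  qed
qed

text \<open>The geometric mean is at most the arithmetic mean, and the factor 1/2 then cancels. The
  resulting bound is linear in the sum, so it can be iterated.\<close>

lemma am_gm_contraction_onE:
  assumes "Metric_space X d" "semimetric_on X \<delta>" "am_gm_contraction_on X d \<delta> T"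
  obtains \<alpha> where "0 \<le> \<alpha>" "\<alpha> < 1"
    "\<And>x y. x \<in> X \<Longrightarrow> y \<in> X \<Longrightarrow> d (T x) (T y) + \<delta> (T x) (T y) \<le> \<alpha> * (d x y + \<delta> x y)"
proof -
  interpret Metric_space X d by fact
  obtain \<alpha> where \<alpha>: "0 \<le> \<alpha>" "\<alpha> < 1" and contr: "\<And>x y. x \<in> X \<Longrightarrow> y \<in> X \<Longrightarrow>
      (d (T x) (T y) + \<delta> (T x) (T y)) / 2 \<le> \<alpha> * sqrt (d x y * \<delta> x y)"
    using assms(3) unfolding am_gm_contraction_on_def by blast
  have "d (T x) (T y) + \<delta> (T x) (T y) \<le> \<alpha> * (d x y + \<delta> x y)" if "x \<in> X" "y \<in> X" for x y
  proof -
    have "\<delta> x y \<ge> 0"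
      using assms(2) that by (simp add: semimetric_on_def)
    then have "\<alpha> * sqrt (d x y * \<delta> x y) \<le> \<alpha> * ((d x y + \<delta> x y) / 2)"
      using \<alpha>(1) by (intro mult_left_mono arith_geo_mean_sqrt) auto
    then show ?thesis
      using contr[OF that] by simp
  qed
  with \<alpha> show ?thesis by (rule that)
qed

theorem corollary3p6:
  fixes X :: "'a set" and d \<delta> :: "'a \<Rightarrow> 'a \<Rightarrow> real" and T :: "'a \<Rightarrow> 'a"
  assumes "X \<noteq> {}"
    and "Metric_space X d"
    and "Metric_space.mcomplete X d"
    and "semimetric_on X \<delta>"
    and "T \<in> X \<rightarrow> X"
    and "am_gm_contraction_on X d \<delta> T"
    and "strongly_regular_on X d \<delta>"
  shows "picard_operator_on X d T"
proof -
  interpret Metric_space X d by fact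
  \<comment> \<open>No triangle inequality is available for \<open>s\<close>. It only carries the
    contraction; Cauchy estimates and limits are taken in \<open>d\<close>, which \<open>s\<close>
    dominates.\<close>
  define s where "s x y = d x y + \<delta> x y" for x y
  have \<delta>_nonneg: "0 \<le> \<delta> x y" if "x \<in> X" "y \<in> X" for x y
    using assms(4) that by (simp add: semimetric_on_def)
  have d_le_s: "d x y \<le> s x y" if "x \<in> X" "y \<in> X" for x y
    using \<delta>_nonneg that by (simp add: s_def)
  obtain \<alpha> where \<alpha>: "0 \<le> \<alpha>" "\<alpha> < 1"
    and contr: "\<And>x y. x \<in> X \<Longrightarrow> y \<in> X \<Longrightarrow> s (T x) (T y) \<le> \<alpha> * s x y"
    using am_gm_contraction_onE[OF assms(2,4,6)] unfolding s_def by metis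
  have TX: "T x \<in> X" if "x \<in> X" for x
    using assms(5) that by auto
  have iter: "(T ^^ n) x \<in> X" if "x \<in> X" for n x
    using that TX by (induction n) auto
  have contr_iter: "s ((T ^^ n) x) ((T ^^ n) y) \<le> s x y * \<alpha> ^ n" if "x \<in> X" "y \<in> X" for n x y
  proof (induction n)
    case (Suc n)
    have "s ((T ^^ Suc n) x) ((T ^^ Suc n) y) \<le> \<alpha> * s ((T ^^ n) x) ((T ^^ n) y)"
      using contr iter that by simp
    also have "\<dots> \<le> \<alpha> * (s x y * \<alpha> ^ n)"
      using Suc.IH \<alpha>(1) by (rule mult_left_mono)
    finally show ?case by (simp add: algebra_simps)
  qed simp
  \<comment> \<open>Because any two orbits approach each other, a limit is needed for one orbit
    only. The same fact later gives uniqueness of the fixed point.\<close>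
  have orbits_merge: "(\<lambda>n. d ((T ^^ n) x) ((T ^^ n) y)) \<longlonglongrightarrow> 0" if "x \<in> X" "y \<in> X" for x y
  proof (rule tendsto_sandwich[OF _ _ tendsto_const])
    show "\<forall>\<^sub>F n in sequentially. d ((T ^^ n) x) ((T ^^ n) y) \<le> s x y * \<alpha> ^ n"
      using d_le_s contr_iter iter that by (meson always_eventually order_trans)
    show "(\<lambda>n. s x y * \<alpha> ^ n) \<longlonglongrightarrow> 0"
      using \<alpha> by (intro tendsto_mult_right_zero LIMSEQ_realpow_zero) auto
  qed simp
  obtain x0 where x0: "x0 \<in> X"
    using assms(1) by blast
  define x where "x n = (T ^^ n) x0" for n
  have xX: "x n \<in> X" for n
    using iter x0 by (simp add: x_def)
  have "MCauchy x"
  proof (rule MCauchy_geometric[OF _ \<alpha>])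
    show "range x \<subseteq> X"
      using xX by auto
    \<comment> \<open>Consecutive terms are the n-th iterates of \<open>x0\<close> and
      \<open>T x0\<close>, whence the constant.\<close>
    show "d (x n) (x (Suc n)) \<le> s x0 (T x0) * \<alpha> ^ n" for n
      using d_le_s[OF xX xX] contr_iter[OF x0 TX[OF x0], of n]
      by (metis funpow_swap1 funpow.simps(2) o_apply order_trans x_def)
  qed
  then obtain u where lim: "limitin mtopology x u sequentially"
    using assms(3) mcomplete_def by blast
  then have u: "u \<in> X" and d_lim: "(\<lambda>n. d (x n) u) \<longlonglongrightarrow> 0"
    by (auto simp: limitin_metric_dist_null)
  have "range x \<subseteq> X"
    using xX by auto
  \<comment> \<open>The contraction bound for \<open>x (Suc n)\<close> and \<open>T u\<close>
    involves \<open>\<delta> (x n) u\<close>, which convergence in \<open>d\<close> alone does not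
    control.\<close>
  then have "(\<lambda>n. \<delta> (x n) u) \<longlonglongrightarrow> 0"
    using assms(7) u d_lim unfolding strongly_regular_on_def by blast
  then have s_lim: "(\<lambda>n. \<alpha> * s (x n) u) \<longlonglongrightarrow> 0"
    unfolding s_def using d_lim by (intro tendsto_mult_right_zero tendsto_add_zero)
  have "(\<lambda>n. d (x (Suc n)) (T u)) \<longlonglongrightarrow> 0"
  proof (rule tendsto_sandwich[OF _ _ tendsto_const s_lim])
    show "\<forall>\<^sub>F n in sequentially. d (x (Suc n)) (T u) \<le> \<alpha> * s (x n) u"
      using d_le_s[OF xX TX[OF u]] contr[OF xX u]
      by (intro always_eventually allI) (metis funpow.simps(2) o_apply order_trans x_def)
  qed simp
  then have "(\<lambda>n. d (x n) (T u)) \<longlonglongrightarrow> 0"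
    by (rule LIMSEQ_imp_Suc)
  then have "limitin mtopology x (T u) sequentially"
    using xX TX[OF u] by (simp add: limitin_metric_dist_null)
  then have fix_u: "T u = u"
    using lim limitin_metric_unique trivial_limit_sequentially by blast
  have iter_fix: "(T ^^ n) v = v" if "T v = v" for n v
    using that by (induction n) auto
  \<comment> \<open>Both orbits are constant, so the constant sequence \<open>d v u\<close> tends to
    0.\<close>
  have "v = u" if "v \<in> X" "T v = v" for v
    using orbits_merge[OF that(1) u] that u by (simp add: iter_fix fix_u LIMSEQ_const_iff)
  \<comment> \<open>The orbit of \<open>u\<close> stays at \<open>u\<close>, so merging with it
    means converging to \<open>u\<close>.\<close>
  moreover have "limitin mtopology (\<lambda>n. (T ^^ n) y) u sequentially" if "y \<in> X" for y
    using orbits_merge[OF that u] iter[OF that] u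
    by (simp add: limitin_metric_dist_null iter_fix fix_u)
  ultimately show ?thesis
    using u fix_u unfolding picard_operator_on_def by blast
qed

end
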